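(* Let $x+H$ be a quasi-translation in dimension $n$ over $\mathbb{C}$ such that $\operatorname{rk}\mathcal{J}H=1$. Then the linear span of the image of $H$ has dimension at most $n-1$. More precisely, if for some $s\ge 0$ we have $H_1=H_2=\cdots=H_s=0$ and $H_{s+1},H_{s+2},\ldots,H_n$ are linearly independent over $\mathbb{C}$, then $s\ge 1$ and $H_i\in\mathbb{C}[x_1,x_2,\ldots,x_s]$ for each $i$.
   Context: Here $x=(x_1,\ldots,x_n)$ and $\mathbb{C}[x]=\mathbb{C}[x_1,\ldots,x_n]$. For $H=(H_1,\ldots,H_n)$ with $H_i\in\mathbb{C}[x]$, the polynomial map $x+H$ is called a quasi-translation if $x-H$ is its inverse polynomial map, i.e. $(x-H)\circ(x+H)=x$. $\mathcal{J}H=\left(\frac{\partial H_i}{\partial x_j}\right)_{i,j}$ is the Jacobian matrix and $\operatorname{rk}$ denotes its rank as a matrix over the field $\mathbb{C}(x)$. The image of $H$ is the image of the map $H:\mathbb{C}^n\to\mathbb{C}^n$, and its linear span is taken over $\mathbb{C}$. *)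

theory Defs
  imports
    "HOL-Analysis.Analysis"
    "HOL-Library.Poly_Mapping"
    "HOL-Computational_Algebra.Fraction_Field"
begin

text \<open>
  The variables \<open>x\<^sub>1, \<dots>, x\<^sub>n\<close> are indexed by a finite linearly ordered type \<open>'n\<close> with
  \<open>CARD('n) = n\<close>. An element of \<^typ>\<open>'n \<Rightarrow>\<^sub>0 nat\<close> is the exponent vector of a monomial and an
  element of the monoid algebra below is a polynomial in \<open>\<complex>[x\<^sub>1, \<dots>, x\<^sub>n]\<close>. Its fraction field
  \<open>'n cpoly fract\<close> is exactly \<open>\<complex>(x\<^sub>1, \<dots>, x\<^sub>n)\<close>; the order on \<open>'n\<close> is what the \<open>idom\<close> instance
  of the monoid algebra requires, and it also provides the numbering of the variables.
\<close>

type_synonym 'n cpoly = "('n \<Rightarrow>\<^sub>0 nat) \<Rightarrow>\<^sub>0 complex"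

text \<open>The 1-based number of an index: the \<open>k\<close>-th smallest element of \<open>'n\<close> gets number \<open>k\<close>.\<close>

definition number :: "'n::{finite,linorder} \<Rightarrow> nat" where
  "number i = card {..i}"

definition Const :: "complex \<Rightarrow> 'n cpoly" where
  "Const c = Poly_Mapping.single 0 c"

definition Var :: "'n \<Rightarrow> 'n cpoly" where
  "Var i = Poly_Mapping.single (Poly_Mapping.single i 1) 1"

text \<open>The polynomial map \<open>x = (x\<^sub>1, \<dots>, x\<^sub>n)\<close>.\<close>

definition id_map :: "('n::finite cpoly)^'n" where
  "id_map = (\<chi> i. Var i)"

text \<open>
  Value of a polynomial at a tuple over an arbitrary commutative \<open>\<complex>\<close>-algebra, whose structure map
  is \<open>\<phi>\<close>. With \<open>\<phi> = id\<close> this is evaluation at a point of \<open>\<complex>\<^sup>n\<close>; with \<open>\<phi> = Const\<close> it is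
  substitution of polynomials.
\<close>

definition eval_poly_in :: "(complex \<Rightarrow> 'r) \<Rightarrow> 'r^'n \<Rightarrow> 'n::finite cpoly \<Rightarrow> 'r::comm_ring_1" where
  "eval_poly_in \<phi> a p =
     (\<Sum>m\<in>Poly_Mapping.keys p.
        \<phi> (Poly_Mapping.lookup p m) * (\<Prod>i\<in>UNIV. (a $ i) ^ Poly_Mapping.lookup m i))"

definition map_of_polys :: "('n::finite cpoly)^'n \<Rightarrow> complex^'n \<Rightarrow> complex^'n" where
  "map_of_polys H a = (\<chi> i. eval_poly_in id a (H $ i))"

definition compose_maps ::
    "('n::finite cpoly)^'n \<Rightarrow> ('n cpoly)^'n \<Rightarrow> ('n cpoly)^'n" where
  "compose_maps F G = (\<chi> i. eval_poly_in Const G (F $ i))"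

definition quasi_translation :: "('n::finite cpoly)^'n \<Rightarrow> bool" where
  "quasi_translation H \<longleftrightarrow> compose_maps (id_map - H) (id_map + H) = id_map"

text \<open>
  Formal partial derivative \<open>\<partial>p/\<partial>x\<^sub>j\<close>. The exponent subtraction is truncated, but where it
  truncates (exponent 0 in \<open>x\<^sub>j\<close>) the coefficient is 0.
\<close>

definition partial_deriv :: "'n \<Rightarrow> 'n cpoly \<Rightarrow> 'n cpoly" where
  "partial_deriv j p =
     (\<Sum>m\<in>Poly_Mapping.keys p.
        Poly_Mapping.single (m - Poly_Mapping.single j 1)
          (of_nat (Poly_Mapping.lookup m j) * Poly_Mapping.lookup p m))"

text \<open>The Jacobian matrix over \<open>\<complex>(x)\<close>; row \<open>i\<close> consists of the derivatives of \<open>H\<^sub>i\<close>.\<close>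

definition jacobian_matrix ::
  "('n cpoly)^'n::{finite,linorder} \<Rightarrow>
    ('n cpoly fract)^'n::{finite,linorder}^'n::{finite,linorder}" where
  "jacobian_matrix H = (\<chi> i j. Fract (partial_deriv j (H $ i)) 1)"

text \<open>
  Linear independence over \<open>\<complex>\<close> of the family \<open>(H\<^sub>i)\<^bsub>i \<in> I\<^esub>\<close>, so that a repeated member makes
  it dependent.
\<close>

definition lin_indep_family :: "'n::finite set \<Rightarrow> ('n cpoly)^'n \<Rightarrow> bool" where
  "lin_indep_family I H \<longleftrightarrow>
     (\<forall>c. (\<Sum>i\<in>I. Const (c i) * H $ i) = 0 \<longrightarrow> (\<forall>i\<in>I. c i = 0))"

definition polys_in :: "'n set \<Rightarrow> 'n cpoly set" where
  "polys_in V = {p. \<forall>m\<in>Poly_Mapping.keys p. Poly_Mapping.keys m \<subseteq> V}"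

end

theory Submission
  imports Defs
    "HOL-Computational_Algebra.Polynomial_Factorial"
    "HOL-Computational_Algebra.Field_as_Ring"
    "HOL-Computational_Algebra.Fundamental_Theorem_Algebra"
begin

text \<open>
  Write \<open>F\<close> for the polynomial map defined by \<open>H\<close>. Evaluating the defining identity of a
  quasi-translation at a point gives \<open>F (x + F x) = F x\<close>. Iteration gives \<open>F (x + k F x) = F x\<close>
  for every natural number \<open>k\<close>, and since both sides are polynomial in \<open>k\<close>, this holds for
  every complex \<open>k\<close>: each value \<open>F x\<close> is a direction in which \<open>F\<close> does not change, if one starts
  at \<open>x\<close> (\<open>quasi_translation_constant_along_own_value\<close>).

  When the Jacobian matrix has rank one, every value \<open>d = F y\<close> is such a direction at every
  point \<open>x\<close> (\<open>constant_along_all_values\<close>). Suppose that \<open>F\<close> is not constant on the line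
  \<open>x + t d\<close>. The image of \<open>F\<close> lies on a curve, and a nonconstant polynomial map from the affine
  line to an irreducible curve is finite, hence surjective. So there is a \<open>t\<close> with
  \<open>F (x + t d) = d\<close>. But then \<open>F\<close> is constant along the line through \<open>x + t d\<close> with direction \<open>d\<close>,
  which is the line we started with: a contradiction.

  The surjectivity is the heart of the proof, and \<open>restriction_attains_all_values\<close> proves it
  without algebraic geometry. Restrict \<open>H\<close> to a plane through the line and \<open>y\<close>, so that
  \<open>H\<^sub>i\<close> becomes \<open>K\<^sub>i(s, t)\<close> with the line at \<open>s = 0\<close>. The polynomials that have zero
  Jacobian determinant with a fixed \<open>K\<^sub>k\<close> form a ring \<open>A\<close> that contains all \<open>K\<^sub>i\<close>. Setting
  \<open>s = 0\<close> is injective on \<open>A\<close>, and makes \<open>\<complex>[t]\<close> a finitely generated \<open>A\<close>-module, because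
  \<open>K\<^sub>k(0, t)\<close> is not constant. By Nakayama's lemma the maximal ideal of \<open>A\<close> at
  the point \<open>y\<close> then generates a proper ideal of \<open>\<complex>[t]\<close>, and a common root of
  that ideal is the parameter \<open>t\<close> we want.

  Differentiating, \<open>\<Sum>\<^sub>j (\<partial>\<^sub>j H\<^sub>k)(x) F\<^sub>j(y) = 0\<close> for all \<open>x\<close>, \<open>y\<close>, \<open>k\<close>
  (\<open>gradient_annihilates_image\<close>). Some \<open>\<partial>\<^sub>j H\<^sub>k\<close> is not zero, which puts the image of \<open>F\<close> into
  a hyperplane. If \<open>H\<^sub>j = 0\<close> for \<open>j \<le> s\<close> and the \<open>H\<^sub>j\<close> with \<open>j > s\<close> are linearly independent,
  the identity, read as a linear relation between the latter, forces \<open>\<partial>\<^sub>j H\<^sub>k = 0\<close> for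
  all \<open>j > s\<close>.
\<close>

section \<open>Evaluation of polynomials in a complex algebra\<close>

definition mono_eval :: "'r::comm_ring_1^'n::finite \<Rightarrow> ('n \<Rightarrow>\<^sub>0 nat) \<Rightarrow> 'r" where
  "mono_eval a m = (\<Prod>i\<in>UNIV. (a $ i) ^ Poly_Mapping.lookup m i)"

lemma mono_eval_add: "mono_eval a (m + m') = mono_eval a m * mono_eval a m'"
  by (simp add: mono_eval_def lookup_add power_add prod.distrib)

lemma mono_eval_0 [simp]: "mono_eval a 0 = 1"
  by (simp add: mono_eval_def)

lemma mono_eval_single [simp]: "mono_eval a (Poly_Mapping.single i 1) = a $ i"
proof -
  have "mono_eval a (Poly_Mapping.single i 1) = (\<Prod>j\<in>UNIV. if j = i then a $ i else 1)"
    unfolding mono_eval_def by (rule prod.cong) (auto simp: lookup_single when_def)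
  then show ?thesis by simp
qed

lemma poly_mapping_sum_monomials:
  "(\<Sum>m\<in>Poly_Mapping.keys p. Poly_Mapping.single m (Poly_Mapping.lookup p m)) = p"
proof (rule poly_mapping_eqI)
  fix k
  have "Poly_Mapping.lookup (\<Sum>m\<in>Poly_Mapping.keys p. Poly_Mapping.single m (Poly_Mapping.lookup p m)) k
      = (\<Sum>m\<in>Poly_Mapping.keys p. if m = k then Poly_Mapping.lookup p k else 0)"
    unfolding lookup_sum by (rule sum.cong) (auto simp: lookup_single when_def)
  also have "\<dots> = Poly_Mapping.lookup p k"
    by (simp add: in_keys_iff)
  finally show "Poly_Mapping.lookup (\<Sum>m\<in>Poly_Mapping.keys p. Poly_Mapping.single m (Poly_Mapping.lookup p m)) k
      = Poly_Mapping.lookup p k" .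
qed

lemma derivation_prod:
  fixes D :: "'r::comm_ring_1 \<Rightarrow> 'r"
  assumes D_mult: "\<And>x y. D (x * y) = x * D y + D x * y" and D_1: "D 1 = 0"
    and "finite S"
  shows "D (\<Prod>i\<in>S. f i) = (\<Sum>j\<in>S. (\<Prod>i\<in>S - {j}. f i) * D (f j))"
  using \<open>finite S\<close>
proof (induction S rule: finite_induct)
  case empty
  show ?case by (simp add: D_1)
next
  case (insert x S)
  have "(\<Sum>j\<in>S. (\<Prod>i\<in>insert x S - {j}. f i) * D (f j)) = (\<Sum>j\<in>S. f x * ((\<Prod>i\<in>S - {j}. f i) * D (f j)))"
  proof (rule sum.cong)
    fix j assume "j \<in> S"
    then have "insert x S - {j} = insert x (S - {j})" using insert.hyps by auto
    then show "(\<Prod>i\<in>insert x S - {j}. f i) * D (f j) = f x * ((\<Prod>i\<in>S - {j}. f i) * D (f j))"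
      using insert.hyps by (simp add: mult.assoc)
  qed simp
  then show ?case
    using insert by (simp add: D_mult sum_distrib_left mult_ac add.commute)
qed

lemma derivation_power:
  fixes D :: "'r::comm_ring_1 \<Rightarrow> 'r"
  assumes D_mult: "\<And>x y. D (x * y) = x * D y + D x * y" and D_1: "D 1 = 0"
  shows "D (x ^ k) = of_nat k * x ^ (k - 1) * D x"
proof (induction k)
  case 0
  then show ?case by (simp add: D_1)
next
  case (Suc k)
  then show ?case by (cases k) (auto simp: D_mult algebra_simps)
qed

lemma derivation_mono_eval:
  fixes D :: "'r::comm_ring_1 \<Rightarrow> 'r"
  assumes D_mult: "\<And>x y. D (x * y) = x * D y + D x * y" and D_1: "D 1 = 0"
  shows "D (mono_eval a m) =
    (\<Sum>j\<in>UNIV. of_nat (Poly_Mapping.lookup m j) * mono_eval a (m - Poly_Mapping.single j 1) * D (a $ j))"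
proof -
  let ?e = "Poly_Mapping.lookup m"
  have "D (mono_eval a m) = (\<Sum>j\<in>UNIV. (\<Prod>i\<in>UNIV - {j}. (a $ i) ^ ?e i) * D ((a $ j) ^ ?e j))"
    unfolding mono_eval_def by (rule derivation_prod) (auto simp: D_mult D_1)
  also have "\<dots> = (\<Sum>j\<in>UNIV. of_nat (?e j) * mono_eval a (m - Poly_Mapping.single j 1) * D (a $ j))"
  proof (rule sum.cong)
    fix j
    have "mono_eval a (m - Poly_Mapping.single j 1)
        = (a $ j) ^ (?e j - 1) * (\<Prod>i\<in>UNIV - {j}. (a $ i) ^ Poly_Mapping.lookup (m - Poly_Mapping.single j 1) i)"
      unfolding mono_eval_def by (subst prod.remove[of _ j]) (auto simp: lookup_minus)
    also have "(\<Prod>i\<in>UNIV - {j}. (a $ i) ^ Poly_Mapping.lookup (m - Poly_Mapping.single j 1) i)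
        = (\<Prod>i\<in>UNIV - {j}. (a $ i) ^ ?e i)"
      by (rule prod.cong) (auto simp: lookup_minus lookup_single)
    finally show "(\<Prod>i\<in>UNIV - {j}. (a $ i) ^ ?e i) * D ((a $ j) ^ ?e j)
        = of_nat (?e j) * mono_eval a (m - Poly_Mapping.single j 1) * D (a $ j)"
      by (simp add: derivation_power[of D, OF D_mult D_1] mult_ac)
  qed simp
  finally show ?thesis .
qed

locale complex_algebra =
  fixes \<phi> :: "complex \<Rightarrow> 'r::comm_ring_1"
  assumes hom_add: "\<phi> (x + y) = \<phi> x + \<phi> y"
    and hom_mult: "\<phi> (x * y) = \<phi> x * \<phi> y"
    and hom_1 [simp]: "\<phi> 1 = 1"
begin

lemma hom_0 [simp]: "\<phi> 0 = 0"
  using hom_add[of 0 0] by simp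

lemma hom_of_nat: "\<phi> (of_nat k) = of_nat k"
  by (induction k) (auto simp: hom_add)

lemma eval_superset:
  assumes "finite S" "Poly_Mapping.keys p \<subseteq> S"
  shows "eval_poly_in \<phi> a p = (\<Sum>m\<in>S. \<phi> (Poly_Mapping.lookup p m) * mono_eval a m)"
  unfolding eval_poly_in_def mono_eval_def
  by (rule sum.mono_neutral_left) (use assms in \<open>auto simp: in_keys_iff\<close>)

lemma eval_0 [simp]: "eval_poly_in \<phi> a 0 = 0"
  by (simp add: eval_poly_in_def)

lemma eval_single: "eval_poly_in \<phi> a (Poly_Mapping.single m c) = \<phi> c * mono_eval a m"
  by (subst eval_superset[of "{m}"]) auto

lemma eval_Const: "eval_poly_in \<phi> a (Const c) = \<phi> c"
  by (simp add: Const_def eval_single)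

lemma eval_Var: "eval_poly_in \<phi> a (Var i) = a $ i"
  using mono_eval_single[of a i] by (simp add: Var_def eval_single)

lemma eval_add: "eval_poly_in \<phi> a (p + q) = eval_poly_in \<phi> a p + eval_poly_in \<phi> a q"
proof -
  let ?S = "Poly_Mapping.keys p \<union> Poly_Mapping.keys q"
  have "Poly_Mapping.keys (p + q) \<subseteq> ?S" by (rule keys_add)
  then show ?thesis
    by (simp add: eval_superset[of ?S] lookup_add hom_add distrib_right sum.distrib)
qed

lemma eval_sum: "eval_poly_in \<phi> a (\<Sum>i\<in>S. f i) = (\<Sum>i\<in>S. eval_poly_in \<phi> a (f i))"
  by (induction S rule: infinite_finite_induct) (auto simp: eval_add)

lemma eval_uminus: "eval_poly_in \<phi> a (- p) = - eval_poly_in \<phi> a p"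
  using eval_add[of a p "- p"] by (simp add: minus_unique)

lemma eval_diff: "eval_poly_in \<phi> a (p - q) = eval_poly_in \<phi> a p - eval_poly_in \<phi> a q"
  using eval_add[of a p "- q"] by (simp add: eval_uminus)

lemma eval_mult: "eval_poly_in \<phi> a (p * q) = eval_poly_in \<phi> a p * eval_poly_in \<phi> a q"
proof -
  let ?c = Poly_Mapping.lookup
  have "p * q = (\<Sum>m\<in>Poly_Mapping.keys p. \<Sum>n\<in>Poly_Mapping.keys q.
      Poly_Mapping.single (m + n) (?c p m * ?c q n))"
    by (subst (1 2) poly_mapping_sum_monomials[symmetric])
      (simp only: sum_product mult_single)
  then have "eval_poly_in \<phi> a (p * q) = (\<Sum>m\<in>Poly_Mapping.keys p. \<Sum>n\<in>Poly_Mapping.keys q.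
      (\<phi> (?c p m) * mono_eval a m) * (\<phi> (?c q n) * mono_eval a n))"
    by (simp add: eval_sum eval_single hom_mult mono_eval_add mult_ac)
  then show ?thesis
    by (simp add: eval_poly_in_def mono_eval_def sum_product)
qed

text \<open>
  The chain rule for an arbitrary derivation \<open>D\<close> that is trivial on the constants. It is applied to
  the derivative of univariate polynomials and to both partial derivatives of bivariate ones.
\<close>

lemma derivation_eval:
  fixes D :: "'r \<Rightarrow> 'r"
  assumes D_add: "\<And>x y. D (x + y) = D x + D y"
    and D_mult: "\<And>x y. D (x * y) = x * D y + D x * y"
    and D_const: "\<And>c. D (\<phi> c) = 0"
  shows "D (eval_poly_in \<phi> a p) = (\<Sum>j\<in>UNIV. eval_poly_in \<phi> a (partial_deriv j p) * D (a $ j))"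
proof -
  let ?c = "Poly_Mapping.lookup p"
  let ?t = "\<lambda>m j. \<phi> (of_nat (Poly_Mapping.lookup m j) * ?c m) * mono_eval a (m - Poly_Mapping.single j 1) * D (a $ j)"
  have D_1: "D 1 = 0" using D_const[of 1] by simp
  have D_sum: "D (\<Sum>i\<in>S. f i) = (\<Sum>i\<in>S. D (f i))" for S and f :: "'x \<Rightarrow> 'r"
    using D_const[of 0] by (induction S rule: infinite_finite_induct) (auto simp: D_add)
  have "D (eval_poly_in \<phi> a p) = (\<Sum>m\<in>Poly_Mapping.keys p. \<phi> (?c m) * D (mono_eval a m))"
    unfolding eval_poly_in_def mono_eval_def[symmetric] D_sum by (simp add: D_mult D_const)
  also have "\<dots> = (\<Sum>m\<in>Poly_Mapping.keys p. \<Sum>j\<in>UNIV. ?t m j)"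
    unfolding derivation_mono_eval[of D, OF D_mult D_1]
    by (simp add: hom_mult hom_of_nat sum_distrib_left mult_ac)
  also have "\<dots> = (\<Sum>j\<in>UNIV. \<Sum>m\<in>Poly_Mapping.keys p. ?t m j)"
    by (rule sum.swap)
  also have "\<dots> = (\<Sum>j\<in>UNIV. eval_poly_in \<phi> a (partial_deriv j p) * D (a $ j))"
    by (simp add: partial_deriv_def eval_sum eval_single sum_distrib_right)
  finally show ?thesis .
qed

lemma hom_eval:
  fixes \<psi> :: "'r \<Rightarrow> 's::comm_ring_1"
  assumes add: "\<And>x y. \<psi> (x + y) = \<psi> x + \<psi> y"
    and mult: "\<And>x y. \<psi> (x * y) = \<psi> x * \<psi> y" and one: "\<psi> 1 = 1"
  shows "\<psi> (eval_poly_in \<phi> a p) = eval_poly_in (\<lambda>c. \<psi> (\<phi> c)) (\<chi> i. \<psi> (a $ i)) p"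
proof -
  have zero: "\<psi> 0 = 0" using add[of 0 0] by simp
  have sum: "\<psi> (\<Sum>i\<in>S. f i) = (\<Sum>i\<in>S. \<psi> (f i))" for S and f :: "'x \<Rightarrow> 'r"
    by (induction S rule: infinite_finite_induct) (auto simp: add zero)
  have prod: "\<psi> (\<Prod>i\<in>S. f i) = (\<Prod>i\<in>S. \<psi> (f i))" for S and f :: "'x \<Rightarrow> 'r"
    by (induction S rule: infinite_finite_induct) (auto simp: mult one)
  have power: "\<psi> (x ^ k) = \<psi> x ^ k" for x k
    by (induction k) (auto simp: mult one)
  show ?thesis by (simp add: eval_poly_in_def sum mult prod power)
qed

end

interpretation id_alg: complex_algebra id
  by unfold_locales auto

lemma lookup_partial_deriv:
  "Poly_Mapping.lookup (partial_deriv j p) m =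
    of_nat (Suc (Poly_Mapping.lookup m j)) * Poly_Mapping.lookup p (m + Poly_Mapping.single j 1)"
proof -
  let ?e = "Poly_Mapping.single j (1::nat)" and ?c = "Poly_Mapping.lookup p"
  have shift: "k - ?e = m \<longleftrightarrow> k = m + ?e" if "Poly_Mapping.lookup k j > 0" for k
  proof
    assume k: "k - ?e = m"
    show "k = m + ?e"
    proof (rule poly_mapping_eqI)
      fix i
      show "Poly_Mapping.lookup k i = Poly_Mapping.lookup (m + ?e) i"
        using that unfolding k[symmetric] by (cases "i = j") (auto simp: lookup_add lookup_minus lookup_single)
    qed
  qed (simp)
  have "Poly_Mapping.lookup (partial_deriv j p) m =
      (\<Sum>k\<in>Poly_Mapping.keys p. if k = m + ?e then of_nat (Poly_Mapping.lookup k j) * ?c k else 0)"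
    unfolding partial_deriv_def lookup_sum
  proof (rule sum.cong)
    fix k
    show "Poly_Mapping.lookup (Poly_Mapping.single (k - ?e) (of_nat (Poly_Mapping.lookup k j) * ?c k)) m
        = (if k = m + ?e then of_nat (Poly_Mapping.lookup k j) * ?c k else 0)"
      using shift[of k] by (cases "Poly_Mapping.lookup k j = 0") (auto simp: lookup_single when_def)
  qed simp
  also have "\<dots> = of_nat (Suc (Poly_Mapping.lookup m j)) * ?c (m + ?e)"
    by (simp add: in_keys_iff lookup_add)
  finally show ?thesis .
qed

text \<open>
  In characteristic zero a nonconstant term survives differentiation, so derivatives determine
  all coefficients but the constant one.
\<close>

lemma lookup_eq_0_if_partial_deriv_lookup_eq_0:
  assumes d: "Poly_Mapping.lookup (partial_deriv j p) (m - Poly_Mapping.single j 1) = 0"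
    and m: "Poly_Mapping.lookup m j > 0"
  shows "Poly_Mapping.lookup p m = 0"
proof -
  have "m - Poly_Mapping.single j 1 + Poly_Mapping.single j 1 = m"
    by (rule poly_mapping_eqI) (use m in \<open>auto simp: lookup_add lookup_minus lookup_single when_def\<close>)
  then show ?thesis using d by (simp add: lookup_partial_deriv del: of_nat_Suc)
qed

lemma partial_deriv_eq_0_imp_polys_in:
  assumes "\<And>j. j \<notin> V \<Longrightarrow> partial_deriv j p = 0"
  shows "p \<in> polys_in V"
proof -
  have "j \<in> V" if m: "m \<in> Poly_Mapping.keys p" and j: "j \<in> Poly_Mapping.keys m" for m j
  proof (rule ccontr)
    assume "j \<notin> V"
    then show False
      using lookup_eq_0_if_partial_deriv_lookup_eq_0[of j p m] assms[of j] m j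
      by (auto simp: in_keys_iff)
  qed
  then show ?thesis by (auto simp: polys_in_def)
qed

section \<open>Restriction to lines\<close>

interpretation line_alg: complex_algebra "\<lambda>c. [:c:]"
  by unfold_locales simp_all

interpretation Const_alg: complex_algebra "Const :: complex \<Rightarrow> 'n::{finite,linorder} cpoly"
  by unfold_locales (auto simp: Const_def single_add mult_single)

text \<open>
  The polynomial \<open>p (x + t d)\<close> in the variable \<open>t\<close>.
\<close>

definition line_poly :: "complex^'n \<Rightarrow> complex^'n \<Rightarrow> 'n::finite cpoly \<Rightarrow> complex poly" where
  "line_poly x d = eval_poly_in (\<lambda>c. [:c:]) (\<chi> i. [:x $ i, d $ i:])"

lemma poly_line_poly: "poly (line_poly x d p) t = eval_poly_in id (x + t *s d) p"
proof -
  have "poly (line_poly x d p) t =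
      eval_poly_in (\<lambda>c. poly [:c:] t) (\<chi> i. poly ((\<chi> i. [:x $ i, d $ i:]) $ i) t) p"
    unfolding line_poly_def by (rule line_alg.hom_eval) auto
  also have "(\<chi> i. poly ((\<chi> i. [:x $ i, d $ i:]) $ i) t) = x + t *s d"
    by (simp add: vec_eq_iff)
  finally show ?thesis by (simp add: id_def)
qed

lemma pderiv_line_poly:
  "pderiv (line_poly x d p) = (\<Sum>j\<in>UNIV. line_poly x d (partial_deriv j p) * [:d $ j:])"
proof -
  let ?z = "\<chi> i. [:x $ i, d $ i:]"
  have "pderiv (line_poly x d p) = (\<Sum>j\<in>UNIV. line_poly x d (partial_deriv j p) * pderiv (?z $ j))"
    unfolding line_poly_def
  proof (rule line_alg.derivation_eval[where D = pderiv])
    show "pderiv (f + g) = pderiv f + pderiv g" for f g :: "complex poly"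
      by (rule pderiv_add)
    show "pderiv (f * g) = f * pderiv g + pderiv f * g" for f g :: "complex poly"
      by (subst pderiv_mult) (rule arg_cong2[where f = plus, OF refl mult.commute])
    show "pderiv [:c:] = 0" for c :: complex
      by (rule pderiv_singleton)
  qed
  also have "\<dots> = (\<Sum>j\<in>UNIV. line_poly x d (partial_deriv j p) * [:d $ j:])"
    by (rule sum.cong) (simp_all only: vec_lambda_beta pderiv_pCons pderiv_0 pCons_0_0 add_0_right pderiv_singleton)
  finally show ?thesis .
qed

lemma directional_derivative_eq:
  "poly (pderiv (line_poly x d p)) 0 = (\<Sum>j\<in>UNIV. eval_poly_in id x (partial_deriv j p) * d $ j)"
  unfolding pderiv_line_poly by (simp add: poly_sum poly_line_poly mult.commute)

text \<open>
  If \<open>p\<close> vanishes everywhere, so do its partial derivatives, by the chain rule along coordinate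
  lines. Differentiating repeatedly turns any given coefficient, up to a nonzero factor, into the
  constant term of a polynomial that vanishes everywhere, and this constant term is the value at
  the origin.
\<close>

lemma poly_eq_0_if_vanishing:
  fixes p :: "'n::finite cpoly"
  assumes "\<And>x. eval_poly_in id x p = 0"
  shows "p = 0"
proof (rule poly_mapping_eqI)
  fix m
  have "Poly_Mapping.lookup p m = 0"
    using assms
  proof (induction "\<Sum>i\<in>UNIV. Poly_Mapping.lookup m i" arbitrary: m p rule: less_induct)
    case (less m p)
    show ?case
    proof (cases "m = 0")
      case True
      \<comment> \<open>The constant term is the value at the origin, where all other monomials vanish.\<close>
      have "eval_poly_in id 0 p = (\<Sum>k\<in>insert 0 (Poly_Mapping.keys p). Poly_Mapping.lookup p k * mono_eval 0 k)"
        using id_alg.eval_superset[of "insert 0 (Poly_Mapping.keys p)" p 0] by (auto simp: id_def)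
      also have "\<dots> = (\<Sum>k\<in>{0}. Poly_Mapping.lookup p k * mono_eval 0 k)"
      proof (rule sum.mono_neutral_right)
        show "\<forall>k\<in>insert 0 (Poly_Mapping.keys p) - {0}. Poly_Mapping.lookup p k * mono_eval 0 k = 0"
        proof
          fix k assume "k \<in> insert 0 (Poly_Mapping.keys p) - {0}"
          then obtain i where "Poly_Mapping.lookup k i \<noteq> 0" by (metis DiffE insertI1 lookup_zero poly_mapping_eqI)
          then have "(\<Prod>i\<in>UNIV. (0::complex) ^ Poly_Mapping.lookup k i) = 0"
            by (intro prod_zero) auto
          then show "Poly_Mapping.lookup p k * mono_eval 0 k = 0" by (simp add: mono_eval_def)
        qed
      qed auto
      finally show ?thesis using less.prems True by simp
    next
      case False
      then obtain j where j: "Poly_Mapping.lookup m j > 0" by (metis gr0I lookup_zero poly_mapping_eqI)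
      have "eval_poly_in id x (partial_deriv j p) = 0" for x
      proof -
        have "line_poly x (axis j 1) p = 0"
          using less.prems by (metis poly_all_0_iff_0 poly_line_poly)
        then have "0 = (\<Sum>i\<in>UNIV. eval_poly_in id x (partial_deriv i p) * axis j 1 $ i)"
          using directional_derivative_eq[of x "axis j 1" p] by simp
        also have "\<dots> = (\<Sum>i\<in>UNIV. if i = j then eval_poly_in id x (partial_deriv i p) else 0)"
          by (rule sum.cong) (auto simp: axis_def)
        finally show ?thesis by simp
      qed
      moreover have "(\<Sum>i\<in>UNIV. Poly_Mapping.lookup (m - Poly_Mapping.single j 1) i) < (\<Sum>i\<in>UNIV. Poly_Mapping.lookup m i)"
        by (rule sum_strict_mono_ex1) (use j in \<open>auto simp: lookup_minus intro!: exI[of _ j]\<close>)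
      ultimately have "Poly_Mapping.lookup (partial_deriv j p) (m - Poly_Mapping.single j 1) = 0"
        using less.hyps by blast
      then show ?thesis using j by (rule lookup_eq_0_if_partial_deriv_lookup_eq_0)
    qed
  qed
  then show "Poly_Mapping.lookup p m = Poly_Mapping.lookup 0 m" by simp
qed

section \<open>Two facts from commutative algebra\<close>

text \<open>
  Nakayama's lemma for the module generated by \<open>g 0, \<dots>, g (m - 1)\<close> over the image of a ring map
  \<open>r\<close>, with \<open>M\<close> in the role of the ideal: if every generator is an \<open>M\<close>-combination of the
  generators, some \<open>1 - e\<close> with \<open>e \<in> M\<close> annihilates all of them. The usual determinant is
  replaced by elimination of the last generator: multiplying the relations by
  \<open>1 - a m m\<close> and substituting the one for \<open>g m\<close> leaves relations of the same shape between the
  other generators.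
\<close>

lemma nakayama_for_generators:
  fixes r :: "'b::comm_ring_1 \<Rightarrow> 'c::comm_ring_1" and g :: "nat \<Rightarrow> 'c"
  assumes r_add: "\<And>a b. r (a + b) = r a + r b"
    and r_mult: "\<And>a b. r (a * b) = r a * r b"
    and M0: "0 \<in> M"
    and M_add: "\<And>a b. a \<in> M \<Longrightarrow> b \<in> M \<Longrightarrow> a + b \<in> M"
    and M_neg: "\<And>a. a \<in> M \<Longrightarrow> - a \<in> M"
    and M_mult: "\<And>a b. a \<in> M \<Longrightarrow> b \<in> M \<Longrightarrow> a * b \<in> M"
    and aM: "\<And>j i. j < m \<Longrightarrow> i < m \<Longrightarrow> a j i \<in> M"
    and eq: "\<And>j. j < m \<Longrightarrow> g j = (\<Sum>i<m. r (a j i) * g i)"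
  shows "\<exists>e\<in>M. \<forall>j<m. (1 - r e) * g j = 0"
  using aM eq
proof (induction m arbitrary: a)
  case 0
  then show ?case using M0 by auto
next
  case (Suc m)
  have r0: "r 0 = 0" using r_add[of 0 0] by simp
  have r_neg: "r (- x) = - r x" for x using r_add[of x "- x"] r0 by (simp add: add_eq_0_iff2 minus_unique)
  have r_diff: "r (x - y) = r x - r y" for x y
    using r_add[of x "- y"] r_neg[of y] by simp
  \<comment> \<open>The summand for i = j takes the term - a m m * g j from the left-hand side to the right.\<close>
  define b where "b j i = a j i - a m m * a j i + a j m * a m i + (if i = j then a m m else 0)" for j i
  have last: "(1 - r (a m m)) * g m = (\<Sum>i<m. r (a m i) * g i)"
    using Suc.prems(2)[of m] by (simp add: algebra_simps)
  have bM: "b j i \<in> M" if "j < m" "i < m" for j i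
  proof -
    have *: "a j i \<in> M" "a j m \<in> M" "a m i \<in> M" "a m m \<in> M" using Suc.prems(1) that by auto
    then have "a j i + - (a m m * a j i) + a j m * a m i + (if i = j then a m m else 0) \<in> M"
      using M0 by (intro M_add M_neg M_mult) auto
    then show ?thesis by (simp add: b_def)
  qed
  have beq: "g j = (\<Sum>i<m. r (b j i) * g i)" if j: "j < m" for j
  proof -
    have gj: "g j = (\<Sum>i<m. r (a j i) * g i) + r (a j m) * g m"
      using Suc.prems(2)[of j] j by simp
    have "(1 - r (a m m)) * g j
        = (1 - r (a m m)) * (\<Sum>i<m. r (a j i) * g i) + r (a j m) * ((1 - r (a m m)) * g m)"
      by (subst gj) (simp add: algebra_simps)
    also have "\<dots> = (\<Sum>i<m. (1 - r (a m m)) * (r (a j i) * g i) + r (a j m) * (r (a m i) * g i))"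
      unfolding last by (simp add: sum_distrib_left sum.distrib)
    finally have 1: "(1 - r (a m m)) * g j = \<dots>" .
    have "(\<Sum>i<m. r (b j i) * g i)
        = (\<Sum>i<m. (1 - r (a m m)) * (r (a j i) * g i) + r (a j m) * (r (a m i) * g i)
            + (if i = j then r (a m m) * g i else 0))"
      by (rule sum.cong) (auto simp: b_def r_add r_mult r_diff r0 algebra_simps)
    also have "\<dots> = (1 - r (a m m)) * g j + r (a m m) * g j"
      unfolding 1 using j by (simp add: sum.distrib)
    finally show ?thesis by (simp add: algebra_simps)
  qed
  obtain e where e: "e \<in> M" "\<forall>j<m. (1 - r e) * g j = 0" using Suc.IH[of b] bM beq by blast
  \<comment> \<open>1 - f is the product of 1 - e, for the other generators, and 1 - a m m, for the last one.\<close>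
  define f where "f = e + a m m + - (e * a m m)"
  have fM: "f \<in> M" unfolding f_def using e Suc.prems(1)[of m m] by (intro M_add M_neg M_mult) auto
  have f1: "1 - r f = (1 - r e) * (1 - r (a m m))"
    unfolding f_def by (simp only: r_add r_neg r_mult) (simp add: algebra_simps)
  have "(1 - r f) * g j = 0" if "j < Suc m" for j
  proof (cases "j = m")
    case True
    have "(1 - r f) * g m = (\<Sum>i<m. r (a m i) * ((1 - r e) * g i))"
      unfolding f1 mult.assoc last by (simp add: sum_distrib_left mult_ac)
    also have "\<dots> = 0" using e(2) by simp
    finally show ?thesis using True by simp
  next
    case False
    then have "(1 - r e) * g j = 0" using that e(2) by auto
    then have "(1 - r (a m m)) * ((1 - r e) * g j) = 0" by simp
    then show ?thesis unfolding f1 by (simp add: mult_ac)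
  qed
  then show ?case using fM by blast
qed

lemma bezout_family:
  fixes p :: "'i \<Rightarrow> 'c::euclidean_ring_gcd"
  assumes "finite S"
  shows "\<exists>b. \<forall>i\<in>S. (\<Sum>j\<in>S. b j * p j) dvd p i"
  using assms
proof (induction S rule: finite_induct)
  case (insert x S)
  then obtain b where b: "\<forall>i\<in>S. (\<Sum>i\<in>S. b i * p i) dvd p i" by blast
  let ?q = "\<Sum>i\<in>S. b i * p i"
  obtain u v where uv: "u * p x + v * ?q = gcd (p x) ?q"
    using bezout_coefficients_fst_snd by blast
  have "(\<Sum>i\<in>insert x S. (if i = x then u else v * b i) * p i) = u * p x + (\<Sum>i\<in>S. v * b i * p i)"
    using insert.hyps by (simp, intro sum.cong) auto
  also have "\<dots> = gcd (p x) ?q" unfolding uv[symmetric] by (simp add: sum_distrib_left mult.assoc)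
  finally have "(\<Sum>i\<in>insert x S. (if i = x then u else v * b i) * p i) = gcd (p x) ?q" .
  moreover have "\<forall>i\<in>insert x S. gcd (p x) ?q dvd p i"
    using b by (auto intro: dvd_trans[OF gcd_dvd2])
  ultimately show ?case
    by (intro exI[of _ "\<lambda>i. if i = x then u else v * b i"]) simp
qed auto

text \<open>
  The weak Nullstellensatz in one variable.
\<close>

lemma coprime_family_bezout:
  fixes p :: "'i \<Rightarrow> complex poly"
  assumes "finite S" and no_root: "\<And>t. \<exists>i\<in>S. poly (p i) t \<noteq> 0"
  shows "\<exists>b. (\<Sum>i\<in>S. b i * p i) = 1"
proof -
  obtain b where b: "\<forall>i\<in>S. (\<Sum>i\<in>S. b i * p i) dvd p i"
    using bezout_family[OF assms(1), of p] by blast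
  define q where "q = (\<Sum>i\<in>S. b i * p i)"
  have "poly q t \<noteq> 0" for t using b no_root[of t] unfolding q_def by (metis dvd_trans poly_eq_0_iff_dvd)
  then have "constant (poly q)" using fundamental_theorem_of_algebra by blast
  then obtain c where c: "q = [:c:]" by (metis constant_degree degree_eq_zeroE)
  with \<open>\<And>t. poly q t \<noteq> 0\<close> have "c \<noteq> 0" by auto
  have "(\<Sum>i\<in>S. ([:inverse c:] * b i) * p i) = [:inverse c:] * q"
    unfolding q_def by (simp only: sum_distrib_left mult.assoc)
  also have "\<dots> = 1" using \<open>c \<noteq> 0\<close> c by simp
  finally show ?thesis by (intro exI[of _ "\<lambda>i. [:inverse c:] * b i"])
qed

section \<open>Functional dependence of bivariate polynomials\<close>

text \<open>
  A polynomial in \<open>s\<close> and \<open>t\<close> is represented as a polynomial in the outer variable \<open>s\<close> whose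
  coefficients are polynomials in the inner variable \<open>t\<close>. So \<^const>\<open>pderiv\<close> is the derivative with
  respect to \<open>s\<close>, and \<open>coeff g 0\<close> is the restriction of \<open>g\<close> to \<open>s = 0\<close>.
\<close>

abbreviation inner_pderiv :: "complex poly poly \<Rightarrow> complex poly poly" where
  "inner_pderiv \<equiv> map_poly pderiv"

text \<open>
  The Jacobian determinant of \<open>g\<close> and \<open>K\<close>. As a function of \<open>g\<close> it is a derivation, so its kernel is
  a subring, which contains \<open>K\<close>.
\<close>

definition jac :: "complex poly poly \<Rightarrow> complex poly poly \<Rightarrow> complex poly poly" where
  "jac K g = inner_pderiv g * pderiv K - pderiv g * inner_pderiv K"

lemma coeff_inner_pderiv [simp]: "coeff (inner_pderiv g) n = pderiv (coeff g n)"
  by (simp add: coeff_map_poly)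

lemma inner_pderiv_add: "inner_pderiv (f + g) = inner_pderiv f + inner_pderiv g"
  by (rule poly_eqI) (simp add: pderiv_add)

lemma inner_pderiv_mult: "inner_pderiv (f * g) = f * inner_pderiv g + inner_pderiv f * g"
proof (rule poly_eqI)
  fix n
  have pd_sum: "pderiv (\<Sum>i\<le>n. h i) = (\<Sum>i\<le>n. pderiv (h i))" for h :: "nat \<Rightarrow> complex poly"
    by (induction n) (auto simp: pderiv_add)
  show "coeff (inner_pderiv (f * g)) n = coeff (f * inner_pderiv g + inner_pderiv f * g) n"
    by (simp add: coeff_mult pd_sum pderiv_mult sum.distrib mult.commute[of "pderiv (coeff f _)"])
qed

lemma jac_add: "jac K (f + g) = jac K f + jac K g"
  by (simp add: jac_def inner_pderiv_add pderiv_add algebra_simps)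

lemma jac_mult: "jac K (f * g) = f * jac K g + jac K f * g"
  by (simp add: jac_def inner_pderiv_mult pderiv_mult algebra_simps)

lemma jac_const [simp]: "jac K [:[:c:]:] = 0"
  by (simp add: jac_def map_poly_pCons)

lemma jac_1 [simp]: "jac K 1 = 0"
  by (simp add: jac_def map_poly_1)

lemma jac_self [simp]: "jac K K = 0"
  by (simp add: jac_def)

lemma jac_uminus: "jac K (- g) = - jac K g"
  using jac_add[of K g "- g"] jac_const[of K 0] by (simp add: add_eq_0_iff2)

lemma jac_diff: "jac K (f - g) = jac K f - jac K g"
  using jac_add[of K f "- g"] by (simp only: jac_uminus diff_conv_add_uminus)

lemma jac_sum: "jac K (\<Sum>i\<in>S. g i) = (\<Sum>i\<in>S. jac K (g i))"
  using jac_const[of K 0] by (induction S rule: infinite_finite_induct) (auto simp: jac_add)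

text \<open>
  Suppose \<open>g\<close> is exactly divisible by \<open>s\<^sup>n\<close> with \<open>n \<ge> 1\<close>. The derivative with respect to \<open>t\<close> keeps
  this divisibility and the one with respect to \<open>s\<close> lowers it by one, so only one of the
  two products in the determinant has a term with \<open>s\<close>-exponent \<open>n - 1\<close>. Its coefficient contains
  the derivative of the restriction of \<open>K\<close> as a factor, so it does not vanish.
\<close>

lemma jac_kernel_restriction_inj:
  assumes J: "jac K g = 0" and g0: "coeff g 0 = 0" and K: "pderiv (coeff K 0) \<noteq> 0"
  shows "g = 0"
proof (rule ccontr)
  assume "g \<noteq> 0"
  define n where "n = (LEAST n. coeff g n \<noteq> 0)"
  have ex: "\<exists>n. coeff g n \<noteq> 0" using \<open>g \<noteq> 0\<close> by (metis leading_coeff_0_iff)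
  have n: "coeff g n \<noteq> 0" unfolding n_def using ex by (rule LeastI_ex)
  have less: "coeff g i = 0" if "i < n" for i using that not_less_Least unfolding n_def by blast
  obtain m where m: "n = Suc m" using n g0 by (cases n) auto
  have "coeff (pderiv g * inner_pderiv K) m
      = (\<Sum>i\<le>m. coeff (pderiv g) i * pderiv (coeff K (m - i)))"
    by (simp add: coeff_mult)
  also have "\<dots> = (\<Sum>i\<in>{m}. coeff (pderiv g) i * pderiv (coeff K (m - i)))"
    by (rule sum.mono_neutral_right) (auto simp: coeff_pderiv less m)
  also have "\<dots> = of_nat n * coeff g n * pderiv (coeff K 0)"
    by (simp add: coeff_pderiv m)
  finally have 1: "coeff (pderiv g * inner_pderiv K) m = \<dots>" .
  have "coeff (inner_pderiv g * pderiv K) m = 0"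
    by (simp add: coeff_mult less m)
  then have "of_nat n * coeff g n * pderiv (coeff K 0) = 0"
    using J 1 by (metis jac_def eq_iff_diff_eq_0)
  then show False using n K m by (simp del: of_nat_Suc)
qed

text \<open>
  Repeated division by the restriction of \<open>K\<close> expands \<open>f\<close> in powers of that restriction, with
  coefficients of degree below \<open>m\<close>. Collecting the terms by powers of \<open>t\<close> shows that
  \<open>1, t, \<dots>, t\<^bsup>m - 1\<^esup>\<close> generate \<open>\<complex>[t]\<close> as a module over the kernel of \<^term>\<open>jac K\<close>.
\<close>

lemma restriction_fin_gen_over_jac_kernel:
  assumes h: "degree (coeff K 0) = m" "m > 0"
  shows "\<exists>a. (\<forall>j<m. jac K (a j) = 0) \<and> f = (\<Sum>j<m. coeff (a j) 0 * [:0, 1:] ^ j)"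
proof (induction "degree f" arbitrary: f rule: less_induct)
  case less
  let ?h = "coeff K 0"
  define q r where "q = f div ?h" and "r = f mod ?h"
  have f: "f = q * ?h + r" unfolding q_def r_def by (rule div_mult_mod_eq[symmetric])
  have h0: "?h \<noteq> 0" using h by auto
  have r_deg: "degree r < m" using degree_mod_less'[of ?h f] h0 h
    by (cases "r = 0") (auto simp: r_def)
  have r_sum: "r = (\<Sum>j<m. [:coeff r j:] * [:0, 1:] ^ j)"
  proof -
    have "r = (\<Sum>j\<le>m - 1. monom (coeff r j) j)"
      by (rule poly_as_sum_of_monoms'[symmetric]) (use r_deg in auto)
    also have "{..m - 1} = {..<m}" using h by auto
    finally show ?thesis by (simp add: monom_altdef)
  qed
  obtain a where a: "\<forall>j<m. jac K (a j) = 0" "q = (\<Sum>j<m. coeff (a j) 0 * [:0, 1:] ^ j)"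
  proof (cases "degree f < m")
    case True
    then have "q = 0" unfolding q_def using h by (simp add: div_poly_less)
    then have "q = (\<Sum>j<m. coeff ((\<lambda>_. [:[:0:]:]) j) 0 * [:0, 1:] ^ j)" by simp
    then show ?thesis using that[of "\<lambda>_. [:[:0:]:]"] by (metis jac_const)
  next
    case False
    have "degree q < degree f"
    proof (cases "q = 0")
      case True
      then show ?thesis using False h by simp
    next
      case q: False
      then have "degree (q * ?h) = degree q + m" using h h0 by (simp add: degree_mult_eq)
      then have "degree f = degree q + m" using f r_deg by (metis degree_add_eq_left trans_less_add2)
      then show ?thesis using h by simp
    qed
    then show ?thesis using less that by blast
  qed
  define b where "b j = K * a j + [:[:coeff r j:]:]" for j
  have "jac K (b j) = 0" if "j < m" for j
    using a(1) that by (simp add: b_def jac_add jac_mult)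
  moreover have "f = (\<Sum>j<m. coeff (b j) 0 * [:0, 1:] ^ j)"
  proof -
    have "f = (\<Sum>j<m. coeff (a j) 0 * [:0, 1:] ^ j) * ?h + (\<Sum>j<m. [:coeff r j:] * [:0, 1:] ^ j)"
      using f a(2) r_sum by simp
    also have "\<dots> = (\<Sum>j<m. ?h * (coeff (a j) 0 * [:0, 1:] ^ j) + [:coeff r j:] * [:0, 1:] ^ j)"
      by (simp only: sum.distrib sum_distrib_left mult.commute[of _ ?h])
    also have "\<dots> = (\<Sum>j<m. coeff (b j) 0 * [:0, 1:] ^ j)"
      by (rule sum.cong) (simp_all add: b_def distrib_right coeff_mult mult.assoc)
    finally show ?thesis .
  qed
  ultimately show ?case by blast
qed

text \<open>
  The point \<open>(K\<^sub>i(s, t0))\<^sub>i\<close> lies on the curve parametrised by \<open>t \<mapsto> (K\<^sub>i(0, t))\<^sub>i\<close>. Otherwise the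
  polynomials \<open>K\<^sub>i(0, t) - K\<^sub>i(s, t0)\<close> generate the unit ideal of \<open>\<complex>[t]\<close>. They are restrictions of
  elements of the ideal \<open>M\<close> of those members of the Jacobian kernel that vanish at \<open>(s, t0)\<close>. Hence
  \<open>M \<complex>[t] = \<complex>[t]\<close>, and Nakayama's lemma gives \<open>e \<in> M\<close> such that the restriction of \<open>1 - e\<close> is zero.
  By injectivity of restriction \<open>e = 1\<close>, although \<open>e\<close> vanishes at \<open>(s, t0)\<close>.
\<close>

lemma restriction_attains_all_values:
  fixes K :: "'i::finite \<Rightarrow> complex poly poly"
  assumes J: "\<And>i. jac (K k) (K i) = 0"
    and nonconst: "pderiv (coeff (K k) 0) \<noteq> 0"
  shows "\<exists>t. \<forall>i. poly (coeff (K i) 0) t = poly (poly (K i) [:s:]) t0"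
proof (rule ccontr)
  assume no: "\<not> ?thesis"
  define ev where "ev g = poly (poly g [:s:]) t0" for g :: "complex poly poly"
  define P where "P i = K i - [:[:ev (K i):]:]" for i
  define p where "p i = coeff (P i) 0" for i
  define M where "M = {g. jac (K k) g = 0 \<and> ev g = 0}"
  define m where "m = degree (coeff (K k) 0)"
  define X :: "complex poly" where "X = [:0, 1:]"
  have m: "m > 0" using nonconst by (auto simp: m_def pderiv_eq_0_iff)
  have PM: "P i \<in> M" for i
    using J[of i]
    by (simp add: P_def M_def jac_diff ev_def)
  have "\<exists>i\<in>UNIV. poly (p i) t \<noteq> 0" for t
    using no by (auto simp: p_def P_def ev_def)
  then obtain b where b: "(\<Sum>i\<in>UNIV. b i * p i) = 1"
    using coprime_family_bezout[of UNIV p] by auto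
  define a where "a j i = (SOME a. (\<forall>l<m. jac (K k) (a l) = 0)
      \<and> X ^ j * b i = (\<Sum>l<m. coeff (a l) 0 * X ^ l))" for j i
  have ex: "\<exists>a. (\<forall>l<m. jac (K k) (a l) = 0)
      \<and> X ^ j * b i = (\<Sum>l<m. coeff (a l) 0 * X ^ l)" for j i
    unfolding X_def by (rule restriction_fin_gen_over_jac_kernel[OF m_def[symmetric] m])
  have a': "(\<forall>l<m. jac (K k) (a j i l) = 0)
      \<and> X ^ j * b i = (\<Sum>l<m. coeff (a j i l) 0 * X ^ l)" for j i
    unfolding a_def by (rule someI_ex[OF ex])
  have a: "jac (K k) (a j i l) = 0" if "l < m" for j i l
    using a'[of j i] that by simp
  have a_sum: "X ^ j * b i = (\<Sum>l<m. coeff (a j i l) 0 * X ^ l)" for j i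
    by (rule a'[THEN conjunct2])
  define c where "c j l = (\<Sum>i\<in>UNIV. a j i l * P i)" for j l
  have cM: "c j l \<in> M" if "l < m" for j l
  proof -
    have "ev (c j l) = (\<Sum>i\<in>UNIV. ev (a j i l) * ev (P i))"
      by (simp add: c_def ev_def poly_sum)
    then show ?thesis using PM a[OF that]
      by (auto simp: M_def c_def jac_sum jac_mult)
  qed
  have gen: "X ^ j = (\<Sum>l<m. coeff (c j l) 0 * X ^ l)" for j
  proof -
    have "X ^ j = X ^ j * (\<Sum>i\<in>UNIV. b i * p i)" unfolding b by simp
    also have "\<dots> = (\<Sum>i\<in>UNIV. (X ^ j * b i) * p i)"
      by (simp add: sum_distrib_left mult.assoc)
    also have "\<dots> = (\<Sum>i\<in>UNIV. \<Sum>l<m. coeff (a j i l) 0 * X ^ l * p i)"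
      unfolding a_sum by (simp add: sum_distrib_right)
    also have "\<dots> = (\<Sum>l<m. \<Sum>i\<in>UNIV. coeff (a j i l) 0 * X ^ l * p i)"
      by (rule sum.swap)
    also have "\<dots> = (\<Sum>l<m. coeff (c j l) 0 * X ^ l)"
      by (simp add: c_def coeff_sum coeff_mult p_def sum_distrib_left mult_ac)
    finally show ?thesis .
  qed
  have "\<exists>e\<in>M. \<forall>j<m. (1 - coeff e 0) * X ^ j = 0"
  proof (rule nakayama_for_generators[where a = c and r = "\<lambda>g. coeff g 0"])
    show "c j i \<in> M" if "i < m" for j i using cM that .
    show "X ^ j = (\<Sum>i<m. coeff (c j i) 0 * X ^ i)" for j by (rule gen)
  qed (use jac_const[of "K k" 0] in \<open>simp_all add: M_def jac_add jac_mult jac_uminus ev_def coeff_mult\<close>)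
  then obtain e where e: "e \<in> M" "\<forall>j<m. (1 - coeff e 0) * X ^ j = 0" by blast
  have "(1 - coeff e 0) * X ^ 0 = 0" using e(2) m by blast
  then have "coeff (1 + - e) 0 = 0" by simp
  moreover have "jac (K k) (1 + - e) = 0"
    using e(1) by (simp add: M_def jac_diff)
  ultimately have "1 + - e = 0" using jac_kernel_restriction_inj nonconst by blast
  then have "ev e = 1" by (simp add: ev_def)
  then show False using e(1) by (simp add: M_def)
qed

section \<open>Restriction to planes\<close>

interpretation plane_alg: complex_algebra "\<lambda>c. [:[:c:]:]"
  by unfold_locales (simp_all flip: one_pCons)

text \<open>
  The polynomial \<open>p (x + t d + s v)\<close>, with \<open>s\<close> as the outer and \<open>t\<close> as the inner variable.
\<close>

definition plane_poly ::
    "complex^'n \<Rightarrow> complex^'n \<Rightarrow> complex^'n \<Rightarrow> 'n::finite cpoly \<Rightarrow> complex poly poly" where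
  "plane_poly x d v = eval_poly_in (\<lambda>c. [:[:c:]:]) (\<chi> i. [:[:x $ i, d $ i:], [:v $ i:]:])"

lemma coeff_plane_poly_0: "coeff (plane_poly x d v p) 0 = line_poly x d p"
proof -
  have "coeff (plane_poly x d v p) 0 = eval_poly_in (\<lambda>c. coeff [:[:c:]:] 0)
      (\<chi> i. coeff ((\<chi> i. [:[:x $ i, d $ i:], [:v $ i:]:]) $ i) 0) p"
    unfolding plane_poly_def
    by (rule plane_alg.hom_eval[where \<psi> = "\<lambda>g. coeff g 0"]) (auto simp: coeff_mult)
  then show ?thesis by (simp add: line_poly_def)
qed

lemma poly_plane_poly: "poly (poly (plane_poly x d v p) 1) 0 = eval_poly_in id (x + v) p"
proof -
  have "poly (poly (plane_poly x d v p) 1) 0 = eval_poly_in (\<lambda>c. poly (poly [:[:c:]:] 1) 0)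
      (\<chi> i. poly (poly ((\<chi> i. [:[:x $ i, d $ i:], [:v $ i:]:]) $ i) 1) 0) p"
    unfolding plane_poly_def
    by (rule plane_alg.hom_eval[where \<psi> = "\<lambda>g. poly (poly g 1) 0"]) (simp_all only: poly_add poly_mult poly_1)
  also have "(\<chi> i. poly (poly ((\<chi> i. [:[:x $ i, d $ i:], [:v $ i:]:]) $ i) 1) 0) = x + v"
    by (simp add: vec_eq_iff mult.commute)
  finally show ?thesis by (simp add: id_def)
qed

text \<open>
  By the chain rule, the Jacobian determinant of the restrictions is a combination of restricted
  \<open>2 \<times> 2\<close> minors of the gradients of \<open>p\<close> and \<open>q\<close>.
\<close>

lemma jac_plane_poly:
  fixes p q :: "'n::finite cpoly" and x d v :: "complex^'n"
  assumes minors: "\<And>a b. partial_deriv a p * partial_deriv b q = partial_deriv b p * partial_deriv a q"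
  shows "jac (plane_poly x d v q) (plane_poly x d v p) = 0"
proof -
  define z :: "complex poly poly^'n" where "z = (\<chi> i. [:[:x $ i, d $ i:], [:v $ i:]:])"
  let ?e = "eval_poly_in (\<lambda>c. [:[:c:]:]) z"
  have P: "plane_poly x d v = ?e" by (simp add: plane_poly_def z_def fun_eq_iff)
  have outer: "pderiv (?e r) = (\<Sum>j\<in>UNIV. ?e (partial_deriv j r) * pderiv (z $ j))" for r
    by (rule plane_alg.derivation_eval[where D = pderiv])
      (simp_all add: pderiv_add pderiv_mult pderiv_pCons mult.commute)
  have inner: "inner_pderiv (?e r) = (\<Sum>j\<in>UNIV. ?e (partial_deriv j r) * inner_pderiv (z $ j))" for r
    by (rule plane_alg.derivation_eval[where D = inner_pderiv])
      (auto simp: inner_pderiv_add inner_pderiv_mult map_poly_pCons)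
  have sym: "?e (partial_deriv a p) * ?e (partial_deriv b q) = ?e (partial_deriv b p) * ?e (partial_deriv a q)" for a b
    unfolding plane_alg.eval_mult[symmetric] minors[of a b] ..
  have "pderiv (?e p) * inner_pderiv (?e q) = (\<Sum>a\<in>UNIV. \<Sum>b\<in>UNIV.
      (?e (partial_deriv a p) * ?e (partial_deriv b q)) * (pderiv (z $ a) * inner_pderiv (z $ b)))"
    unfolding outer inner sum_product by (simp add: mult_ac)
  also have "\<dots> = (\<Sum>a\<in>UNIV. \<Sum>b\<in>UNIV.
      (?e (partial_deriv b p) * ?e (partial_deriv a q)) * (pderiv (z $ a) * inner_pderiv (z $ b)))"
    unfolding sym ..
  also have "\<dots> = (\<Sum>b\<in>UNIV. \<Sum>a\<in>UNIV.
      (?e (partial_deriv b p) * ?e (partial_deriv a q)) * (pderiv (z $ a) * inner_pderiv (z $ b)))"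
    by (rule sum.swap)
  also have "\<dots> = inner_pderiv (?e p) * pderiv (?e q)"
    unfolding outer inner sum_product by (simp add: mult_ac)
  finally show ?thesis by (simp add: jac_def P)
qed

section \<open>Quasi-translations\<close>

lemma map_of_polys_nth: "map_of_polys H x $ i = eval_poly_in id x (H $ i)"
  by (simp add: map_of_polys_def)

lemma quasi_translation_shift:
  fixes H :: "('n cpoly)^'n::{finite,linorder}"
  assumes "quasi_translation H"
  shows "map_of_polys H (x + map_of_polys H x) = map_of_polys H x"
proof -
  have "eval_poly_in id (x + map_of_polys H x) (H $ i) = eval_poly_in id x (H $ i)" for i
  proof -
    have "eval_poly_in Const (id_map + H) (Var i - H $ i) = (Var i :: 'n cpoly)"
      using assms by (simp add: quasi_translation_def compose_maps_def vec_eq_iff id_map_def)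
    then have "x $ i = eval_poly_in id x (eval_poly_in Const (id_map + H) (Var i - H $ i))"
      by (simp add: id_alg.eval_Var)
    also have "\<dots> = eval_poly_in (\<lambda>c. eval_poly_in id x (Const c))
        (\<chi> j. eval_poly_in id x ((id_map + H) $ j)) (Var i - H $ i)"
      by (rule Const_alg.hom_eval[where \<psi> = "eval_poly_in id x",
            OF id_alg.eval_add id_alg.eval_mult])
        (simp only: id_alg.eval_Const id_apply flip: Const_alg.hom_1)
    also have "(\<chi> j. eval_poly_in id x ((id_map + H) $ j)) = x + map_of_polys H x"
      by (simp add: vec_eq_iff id_map_def id_alg.eval_add id_alg.eval_Var map_of_polys_nth)
    also have "(\<lambda>c. eval_poly_in id x (Const c)) = id"
      by (rule ext) (rule id_alg.eval_Const)
    finally have "x $ i = eval_poly_in id (x + map_of_polys H x) (Var i - H $ i)" .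
    then show ?thesis
      unfolding id_alg.eval_diff id_alg.eval_Var by (simp add: map_of_polys_nth)
  qed
  then show ?thesis by (simp add: vec_eq_iff map_of_polys_nth)
qed

text \<open>
  Iterating the shift gives the identity for natural numbers \<open>t\<close>, and two polynomials in \<open>t\<close> that
  agree at every natural number are equal.
\<close>

lemma quasi_translation_constant_along_own_value:
  fixes H :: "('n cpoly)^'n::{finite,linorder}"
  assumes "quasi_translation H"
  shows "map_of_polys H (x + t *s map_of_polys H x) = map_of_polys H x"
proof -
  let ?F = "map_of_polys H"
  have nat: "?F (x + of_nat k *s ?F x) = ?F x" for k
  proof (induction k)
    case (Suc k)
    have "x + of_nat (Suc k) *s ?F x = (x + of_nat k *s ?F x) + ?F (x + of_nat k *s ?F x)"
      unfolding Suc by (simp add: vec_eq_iff algebra_simps)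
    then show ?case using quasi_translation_shift[OF assms] Suc by metis
  qed simp
  have "line_poly x (?F x) (H $ i) = [:?F x $ i:]" for i
  proof (rule ccontr)
    let ?q = "line_poly x (?F x) (H $ i) - [:?F x $ i:]"
    assume "\<not> ?thesis"
    then have "finite {t. poly ?q t = 0}" by (intro poly_roots_finite) simp
    moreover have "range of_nat \<subseteq> {t. poly ?q t = 0}"
      using nat by (auto simp: poly_line_poly simp flip: map_of_polys_nth)
    ultimately have "finite (range (of_nat :: nat \<Rightarrow> complex))" by (rule finite_subset[rotated])
    then show False by (simp add: finite_image_iff inj_of_nat)
  qed
  then have "poly (line_poly x (?F x) (H $ i)) t = ?F x $ i" for i by simp
  then show ?thesis by (simp add: poly_line_poly vec_eq_iff map_of_polys_nth)
qed

section \<open>Quasi-translations with a Jacobian matrix of rank one\<close>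

text \<open>
  All rows are multiples of one vector.
\<close>

lemma rank_1_imp_minors:
  fixes A :: "'a::field^'n^'m"
  assumes "rank A = 1"
  shows "A $ i $ a * A $ k $ b = A $ i $ b * A $ k $ a"
proof -
  obtain B where B: "rows A \<subseteq> vec.span B" "card B = vec.dim (rows A)"
    using vec.basis_exists by metis
  then obtain u where u: "B = {u}"
    using assms by (auto simp: row_rank_def_gen card_1_singleton_iff)
  have "\<exists>c. \<forall>j. A $ i $ j = c * u $ j" for i
  proof -
    have "row i A \<in> vec.span {u}" using B u by (auto simp: rows_def)
    then obtain c where "row i A = c *s u" by (auto simp: vec.span_singleton)
    then have "\<forall>j. A $ i $ j = c * u $ j" by (simp add: vec_eq_iff row_def)
    then show ?thesis ..
  qed
  then obtain c where "\<And>i j. A $ i $ j = c i * u $ j" by metis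
  then show ?thesis by (simp add: mult_ac)
qed

lemma partial_deriv_minors:
  fixes H :: "('n cpoly)^'n::{finite,linorder}"
  assumes "rank (jacobian_matrix H) = 1"
  shows "partial_deriv a (H $ i) * partial_deriv b (H $ k)
    = partial_deriv b (H $ i) * partial_deriv a (H $ k)"
  using rank_1_imp_minors[OF assms, of i a k b] by (simp add: jacobian_matrix_def eq_fract)

text \<open>
  Otherwise some point \<open>z\<close> of the line has value \<open>F z = F y\<close>, by surjectivity onto the image
  curve. Since \<open>F y\<close> is then its own value at \<open>z\<close>, the map is constant along the direction \<open>F y\<close>
  through \<open>z\<close>, which is the whole line.
\<close>

lemma constant_along_all_values:
  fixes H :: "('n cpoly)^'n::{finite,linorder}"
  assumes qt: "quasi_translation H" and rk: "rank (jacobian_matrix H) = 1"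
  shows "pderiv (line_poly x (map_of_polys H y) (H $ k)) = 0"
proof (rule ccontr)
  let ?F = "map_of_polys H"
  define d where "d = ?F y"
  assume "\<not> ?thesis"
  then have nonconst: "pderiv (line_poly x d (H $ k)) \<noteq> 0" by (simp add: d_def)
  \<comment> \<open>The plane contains the line as s = 0 and the point y as s = 1, t = 0.\<close>
  define K where "K i = plane_poly x d (y - x) (H $ i)" for i
  have K0: "coeff (K i) 0 = line_poly x d (H $ i)" for i by (simp add: K_def coeff_plane_poly_0)
  have "\<exists>t. \<forall>i. poly (coeff (K i) 0) t = poly (poly (K i) [:1:]) 0"
  proof (rule restriction_attains_all_values)
    show "jac (K k) (K i) = 0" for i
      unfolding K_def by (rule jac_plane_poly) (rule partial_deriv_minors[OF rk])
    show "pderiv (coeff (K k) 0) \<noteq> 0" using nonconst by (simp add: K0)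
  qed
  then obtain t where t: "\<And>i. poly (line_poly x d (H $ i)) t = d $ i"
    by (auto simp: coeff_plane_poly_0 K_def poly_plane_poly d_def map_of_polys_nth)
  then have Fd: "?F (x + t *s d) = d"
    by (simp add: vec_eq_iff map_of_polys_nth poly_line_poly)
  have "poly (line_poly x d (H $ k)) s = poly [:d $ k:] s" for s
  proof -
    have "x + s *s d = (x + t *s d) + (s - t) *s ?F (x + t *s d)"
      unfolding Fd by (simp add: vec_eq_iff algebra_simps)
    then have "?F (x + s *s d) = d"
      using quasi_translation_constant_along_own_value[OF qt, of "x + t *s d" "s - t"] Fd by simp
    then show ?thesis by (simp add: poly_line_poly flip: map_of_polys_nth)
  qed
  then have "line_poly x d (H $ k) = [:d $ k:]" by (intro iffD1[OF poly_eq_poly_eq_iff] ext)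
  then show False using nonconst by simp
qed

lemma gradient_annihilates_image:
  fixes H :: "('n cpoly)^'n::{finite,linorder}"
  assumes "quasi_translation H" and "rank (jacobian_matrix H) = 1"
  shows "(\<Sum>j\<in>UNIV. eval_poly_in id x (partial_deriv j (H $ k)) * map_of_polys H y $ j) = 0"
  using directional_derivative_eq[of x "map_of_polys H y" "H $ k"]
    constant_along_all_values[OF assms, of x y k] by simp

theorem theorem5p5:
  fixes H :: "('n cpoly)^'n::{finite,linorder}"
  assumes "quasi_translation H"
    and "rank (jacobian_matrix H) = 1"
  shows "vec.dim (vec.span (range (map_of_polys H))) \<le> CARD('n) - 1 \<and>
    (\<forall>s \<le> CARD('n).
       (\<forall>i. number i \<le> s \<longrightarrow> H $ i = 0) \<and> lin_indep_family {i. number i > s} H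
       \<longrightarrow> s \<ge> 1 \<and> (\<forall>i. H $ i \<in> polys_in {j. number j \<le> s}))"
proof -
  define c where "c x k j = eval_poly_in id x (partial_deriv j (H $ k))" for x k j
  have ann: "(\<Sum>j\<in>UNIV. c x k j * map_of_polys H y $ j) = 0" for x k y
    unfolding c_def by (rule gradient_annihilates_image[OF assms])
  have "jacobian_matrix H \<noteq> 0"
  proof
    assume "jacobian_matrix H = 0"
    then have "rows (jacobian_matrix H) \<subseteq> {0}" by (auto simp: rows_def row_def vec_eq_iff)
    then have "rank (jacobian_matrix H) = 0" unfolding row_rank_def_gen by simp
    then show False using assms(2) by simp
  qed
  then obtain k j where "Fract (partial_deriv j (H $ k)) 1 \<noteq> 0"
    by (auto simp: jacobian_matrix_def vec_eq_iff)
  then have nz: "partial_deriv j (H $ k) \<noteq> 0" by (metis Zero_fract_def)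
  then obtain x where x: "c x k j \<noteq> 0"
    unfolding c_def using poly_eq_0_if_vanishing by blast
  have "vec.dim (vec.span (range (map_of_polys H))) \<le> CARD('n) - 1"
  proof -
    \<comment> \<open>A hyperplane, since its equation has the nonzero coefficient c x k j.\<close>
    let ?W = "{v. (\<Sum>j\<in>UNIV. c x k j * v $ j) = 0}"
    have sub: "vec.subspace ?W"
      by (rule vec.subspaceI)
        (auto simp: distrib_left sum.distrib mult.left_commute simp flip: sum_distrib_left)
    have "vec.span (range (map_of_polys H)) \<subseteq> ?W"
      by (rule vec.span_minimal[OF _ sub]) (auto simp: ann)
    moreover have "axis j 1 \<notin> ?W"
    proof -
      have "(\<Sum>i\<in>UNIV. c x k i * axis j 1 $ i) = (\<Sum>i\<in>UNIV. if i = j then c x k i else 0)"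
        by (rule sum.cong) (auto simp: axis_def)
      then show ?thesis using x by simp
    qed
    ultimately have "vec.span (range (map_of_polys H)) \<noteq> UNIV" by blast
    then have "vec.dim (range (map_of_polys H)) \<noteq> CARD('n)"
      using vec.dim_eq_full[of "range (map_of_polys H)"]
      by (simp add: vec.dimension_def card_cart_basis)
    moreover have "vec.dim (range (map_of_polys H)) \<le> CARD('n)"
      using vec.dim_subset_UNIV[of "range (map_of_polys H)"]
      by (simp add: vec.dimension_def card_cart_basis)
    ultimately show ?thesis by simp
  qed
  moreover have "s \<ge> 1 \<and> (\<forall>i. H $ i \<in> polys_in {j. number j \<le> s})"
    if zero: "\<forall>i. number i \<le> s \<longrightarrow> H $ i = 0" and indep: "lin_indep_family {i. number i > s} H" for s
  proof -
    have van: "partial_deriv l (H $ i) = 0" if l: "number l > s" for i l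
    proof (rule poly_eq_0_if_vanishing)
      fix z
      have "(\<Sum>j\<in>{j. number j > s}. Const (c z i j) * H $ j) = 0"
      proof (rule poly_eq_0_if_vanishing)
        fix y
        have "eval_poly_in id y (\<Sum>j\<in>{j. number j > s}. Const (c z i j) * H $ j)
            = (\<Sum>j\<in>{j. number j > s}. c z i j * map_of_polys H y $ j)"
          by (simp add: id_alg.eval_sum id_alg.eval_mult id_alg.eval_Const map_of_polys_nth)
        also have "\<dots> = (\<Sum>j\<in>UNIV. c z i j * map_of_polys H y $ j)"
          by (rule sum.mono_neutral_left) (use zero in \<open>auto simp: map_of_polys_nth not_less\<close>)
        finally show "eval_poly_in id y (\<Sum>j\<in>{j. number j > s}. Const (c z i j) * H $ j) = 0"
          by (simp add: ann)
      qed
      then show "eval_poly_in id z (partial_deriv l (H $ i)) = 0"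
        using indep l by (auto simp: lin_indep_family_def c_def)
    qed
    have "H $ i \<in> polys_in {j. number j \<le> s}" for i
      by (rule partial_deriv_eq_0_imp_polys_in) (use van in auto)
    moreover have "s \<ge> 1"
    proof (rule ccontr)
      assume "\<not> s \<ge> 1"
      moreover have "number j > 0" by (auto simp: number_def card_gt_0_iff)
      ultimately have "number j > s" by simp
      then show False using van nz by blast
    qed
    ultimately show ?thesis by blast
  qed
  ultimately show ?thesis by blast
qed

end
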